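(* Let $f:\mathbb{R}^d\to\mathbb{R}$ be convex with $L$-Lipschitz continuous gradient ($L>0$), let $x^*$ be a minimizer of $f$, and let $\mathcal{C}$ be an $\omega$-compression operator ($\omega\ge 0$). Run the ACGD algorithm (defined in the context) from $x^0\in\mathbb{R}^d$ with parameters $$\eta_k\equiv\frac1L,\quad p=1+\omega,\quad \theta_k=\frac{k}{k+2},\quad \beta_k\equiv 0,\quad \gamma_k=\frac{2p}{k+2}.$$ Then the number of iterations performed by ACGD to find an $\epsilon$-solution, i.e. an iterate with $\mathbb{E}[f(x^k)]-f(x^* )\le\epsilon$, is at most $k=O\big((1+\omega)\sqrt{L/\epsilon}\big)$. That is: there is a constant $C>0$ depending only on $\|x^0-x^*\|$ (not on $f$, $d$, $L$, $\omega$, $\mathcal{C}$ or $\epsilon$) such that for every $\epsilon>0$ there is an integer $k\ge 0$ with $k\le C(1+\omega)\sqrt{L/\epsilon}$ and $\mathbb{E}[f(x^k)]-f(x^* )\le\epsilon$.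
   Context: $\|\cdot\|$ is the Euclidean norm. A randomized map $\mathcal{C}:\mathbb{R}^d\to\mathbb{R}^d$ is an $\omega$-compression operator if $\mathbb{E}[\mathcal{C}(x)]=x$ and $\mathbb{E}[\|\mathcal{C}(x)-x\|^2]\le\omega\|x\|^2$ for all $x\in\mathbb{R}^d$. ACGD (accelerated compressed gradient descent), with input $x^0$, $\{\eta_k\},\{\theta_k\},\{\beta_k\},\{\gamma_k\}$, $p$: set $z^0=y^0=x^0$, and for $k=0,1,2,\dots$ do 1. $x^k=\theta_k y^k+(1-\theta_k)z^k$; 2. $g^k=\mathcal{C}(\nabla f(x^k))$, where the randomness of $\mathcal{C}$ is drawn afresh at each iteration, independently of the past; 3. $y^{k+1}=x^k-\frac{\eta_k}{p}g^k$; 4. $z^{k+1}=\frac1{\gamma_k}y^{k+1}+\big(\frac1p-\frac1{\gamma_k}\big)y^k+\big(1-\frac1p\big)(1-\beta_k)z^k+\big(1-\frac1p\big)\beta_k x^k$. The expectation is over all the randomness of the algorithm. *)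

theory Defs
  imports "HOL-Probability.Probability" "HOL-Library.Function_Algebras"
begin

text \<open>
  The dimension has to be a term: the constant of the theorem is chosen before the dimension,
  which a type-indexed space such as \<open>real ^ 'n\<close> cannot express. Hence \<open>\<real>\<^sup>d\<close> is the set of all
  real sequences vanishing from position \<open>d\<close> on. The library already provides pointwise addition
  of functions and the product topology, which on this set is the Euclidean one; its metric on
  functions is not the Euclidean metric, and is not used.
\<close>

instantiation "fun" :: (type, real_vector) real_vector
begin

definition scaleR_fun :: "real \<Rightarrow> ('a \<Rightarrow> 'b) \<Rightarrow> 'a \<Rightarrow> 'b" where
  "scaleR_fun c f = (\<lambda>i. c *\<^sub>R f i)"

instance
  by standard
    (simp_all add: scaleR_fun_def fun_eq_iff scaleR_add_right scaleR_add_left)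

end

lemma scaleR_fun_apply [simp]: "(c *\<^sub>R f) i = c *\<^sub>R f i"
  by (simp add: scaleR_fun_def)

type_synonym rvec = "nat \<Rightarrow> real"

definition Rd :: "nat \<Rightarrow> rvec set" where
  "Rd d = {x. \<forall>i\<ge>d. x i = 0}"

definition Rd_borel :: "nat \<Rightarrow> rvec measure" where
  "Rd_borel d = restrict_space borel (Rd d)"

definition enorm :: "nat \<Rightarrow> rvec \<Rightarrow> real" where
  "enorm d x = L2_set x {..<d}"

definition einner :: "nat \<Rightarrow> rvec \<Rightarrow> rvec \<Rightarrow> real" where
  "einner d x y = (\<Sum>i<d. x i * y i)"

text \<open>\<open>f\<close> is (Frechet) differentiable at \<open>x\<close> with gradient \<open>v\<close>.\<close>

definition has_gradient :: "nat \<Rightarrow> (rvec \<Rightarrow> real) \<Rightarrow> rvec \<Rightarrow> rvec \<Rightarrow> bool" where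
  "has_gradient d f x v \<longleftrightarrow> v \<in> Rd d \<and>
     (\<forall>e>0. \<exists>r>0. \<forall>h\<in>Rd d. enorm d h < r \<longrightarrow>
        \<bar>f (x + h) - f x - einner d v h\<bar> \<le> e * enorm d h)"

text \<open>
  A randomized map is a Markov kernel: \<open>C x\<close> is the distribution of its output at \<open>x\<close>. The
  expectation of a vector is taken coordinatewise. Integrability is demanded explicitly because
  the integral of a non-integrable function is \<open>0\<close> by convention.
\<close>

definition compression_operator :: "nat \<Rightarrow> real \<Rightarrow> (rvec \<Rightarrow> rvec measure) \<Rightarrow> bool" where
  "compression_operator d \<omega> C \<longleftrightarrow>
     C \<in> Rd_borel d \<rightarrow>\<^sub>M prob_algebra (Rd_borel d) \<and>
     (\<forall>x\<in>Rd d.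
        (\<forall>i<d. integrable (C x) (\<lambda>g. g i) \<and> (\<integral>g. g i \<partial>C x) = x i) \<and>
        integrable (C x) (\<lambda>g. (enorm d (g - x))\<^sup>2) \<and>
        (\<integral>g. (enorm d (g - x))\<^sup>2 \<partial>C x) \<le> \<omega> * (enorm d x)\<^sup>2)"

definition acgd_x :: "(nat \<Rightarrow> real) \<Rightarrow> nat \<Rightarrow> rvec \<Rightarrow> rvec \<Rightarrow> rvec" where
  "acgd_x \<theta> k y z = \<theta> k *\<^sub>R y + (1 - \<theta> k) *\<^sub>R z"

definition acgd_y :: "(nat \<Rightarrow> real) \<Rightarrow> real \<Rightarrow> nat \<Rightarrow> rvec \<Rightarrow> rvec \<Rightarrow> rvec" where
  "acgd_y \<eta> p k x g = x - (\<eta> k / p) *\<^sub>R g"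

definition acgd_z ::
  "(nat \<Rightarrow> real) \<Rightarrow> (nat \<Rightarrow> real) \<Rightarrow> real \<Rightarrow> nat \<Rightarrow> rvec \<Rightarrow> rvec \<Rightarrow> rvec \<Rightarrow> rvec \<Rightarrow> rvec" where
  "acgd_z \<beta> \<gamma> p k x y z y' =
     (1 / \<gamma> k) *\<^sub>R y' + (1 / p - 1 / \<gamma> k) *\<^sub>R y
     + ((1 - 1 / p) * (1 - \<beta> k)) *\<^sub>R z + ((1 - 1 / p) * \<beta> k) *\<^sub>R x"

text \<open>
  The joint distribution of \<open>(y\<^sup>k, z\<^sup>k)\<close>, where \<open>G\<close> is the gradient map of the objective.
  Each step draws \<open>g\<close> from the kernel \<open>C\<close> at \<open>G x\<close>, and this distribution depends on the past
  only through \<open>(y\<^sup>k, z\<^sup>k)\<close>: this is the fresh, independent randomness of every iteration.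
\<close>

primrec acgd_state ::
  "nat \<Rightarrow> (rvec \<Rightarrow> rvec measure) \<Rightarrow> (rvec \<Rightarrow> rvec) \<Rightarrow> (nat \<Rightarrow> real) \<Rightarrow> (nat \<Rightarrow> real) \<Rightarrow>
   (nat \<Rightarrow> real) \<Rightarrow> (nat \<Rightarrow> real) \<Rightarrow> real \<Rightarrow> rvec \<Rightarrow> nat \<Rightarrow> (rvec \<times> rvec) measure" where
  "acgd_state d C G \<eta> \<theta> \<beta> \<gamma> p x0 0 = return (Rd_borel d \<Otimes>\<^sub>M Rd_borel d) (x0, x0)"
| "acgd_state d C G \<eta> \<theta> \<beta> \<gamma> p x0 (Suc k) =
     do {
       (y, z) \<leftarrow> acgd_state d C G \<eta> \<theta> \<beta> \<gamma> p x0 k;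
       let x = acgd_x \<theta> k y z;
       g \<leftarrow> C (G x);
       let y' = acgd_y \<eta> p k x g;
       return (Rd_borel d \<Otimes>\<^sub>M Rd_borel d) (y', acgd_z \<beta> \<gamma> p k x y z y')
     }"

text \<open>The distribution of the iterate \<open>x\<^sup>k\<close>.\<close>

definition acgd_iterate ::
  "nat \<Rightarrow> (rvec \<Rightarrow> rvec measure) \<Rightarrow> (rvec \<Rightarrow> rvec) \<Rightarrow> (nat \<Rightarrow> real) \<Rightarrow> (nat \<Rightarrow> real) \<Rightarrow>
   (nat \<Rightarrow> real) \<Rightarrow> (nat \<Rightarrow> real) \<Rightarrow> real \<Rightarrow> rvec \<Rightarrow> nat \<Rightarrow> rvec measure" where
  "acgd_iterate d C G \<eta> \<theta> \<beta> \<gamma> p x0 k =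
     distr (acgd_state d C G \<eta> \<theta> \<beta> \<gamma> p x0 k) (Rd_borel d) (\<lambda>(y, z). acgd_x \<theta> k y z)"

end

theory Submission
  imports Defs
begin

text \<open>
  With these parameters the \<open>z\<close>-update collapses to \<open>z\<^sup>k - \<alpha>\<^sub>k g\<^sup>k\<close>, \<open>\<alpha>\<^sub>k = (k + 2) / (2 L p\<^sup>2)\<close>, so that
  ACGD is an accelerated method with gradient noise \<open>E \<parallel>g\<parallel>\<^sup>2 \<le> p \<parallel>\<nabla>f\<parallel>\<^sup>2\<close>. The potential
  \<open>\<alpha>\<^sub>k k/2 (f(y\<^sup>k) - f(x*)) + \<parallel>z\<^sup>k - x*\<parallel>\<^sup>2 / 2\<close> decreases in expectation. Using the inequality
  \<open>f(x*) \<ge> f(x) + \<langle>\<nabla>f(x), x* - x\<rangle> + \<parallel>\<nabla>f(x)\<parallel>\<^sup>2 / (2 L)\<close> instead of plain convexity, it even decreases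
  by \<open>\<alpha>\<^sub>k E \<parallel>\<nabla>f(x\<^sup>k)\<parallel>\<^sup>2 / (2 L)\<close>, so these gains sum to at most \<open>\<parallel>x\<^sup>0 - x*\<parallel>\<^sup>2 / 2\<close>. Since \<open>f(x\<^sup>k)\<close> is bounded
  by the potential and the gain, it is of order \<open>L p\<^sup>2 / N\<^sup>2\<close> for some \<open>k\<close> between \<open>N\<close> and \<open>2 N\<close>.
\<close>

section \<open>Euclidean geometry of \<open>Rd d\<close> in coordinates\<close>

lemma Rd_closed [simp]:
  assumes "x \<in> Rd d"
  shows "y \<in> Rd d \<Longrightarrow> x + y \<in> Rd d" "y \<in> Rd d \<Longrightarrow> x - y \<in> Rd d" "a *\<^sub>R x \<in> Rd d"
  using assms by (auto simp: Rd_def)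

lemma einner_simps:
  "einner d (x + y) z = einner d x z + einner d y z"
  "einner d (x - y) z = einner d x z - einner d y z"
  "einner d (a *\<^sub>R x) z = a * einner d x z"
  "einner d (- x) z = - einner d x z"
  "einner d z (x + y) = einner d z x + einner d z y"
  "einner d z (x - y) = einner d z x - einner d z y"
  "einner d z (a *\<^sub>R x) = a * einner d z x"
  "einner d z (- x) = - einner d z x"
  by (simp_all add: einner_def algebra_simps sum.distrib sum_subtractf sum_negf sum_distrib_left)

lemma einner_commute: "einner d x y = einner d y x"
  by (simp add: einner_def mult.commute)

lemma enorm_sq: "(enorm d x)\<^sup>2 = einner d x x"
  unfolding enorm_def L2_set_def einner_def by (simp add: sum_nonneg power2_eq_square)

lemma enorm_nonneg [simp]: "0 \<le> enorm d x"
  by (simp add: enorm_def)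

lemma enorm_scaleR: "enorm d (a *\<^sub>R x) = \<bar>a\<bar> * enorm d x"
proof -
  have "(enorm d (a *\<^sub>R x))\<^sup>2 = (\<bar>a\<bar> * enorm d x)\<^sup>2"
    by (simp add: enorm_sq einner_simps power_mult_distrib power2_eq_square[of a])
  then show ?thesis
    by (simp add: power2_eq_iff_nonneg)
qed

lemma einner_self_nonneg [simp]: "0 \<le> einner d x x"
  by (simp flip: enorm_sq)

lemma einner_le_enorm: "einner d x y \<le> enorm d x * enorm d y"
proof -
  have "einner d x y \<le> (\<Sum>i<d. \<bar>x i\<bar> * \<bar>y i\<bar>)"
    unfolding einner_def by (intro sum_mono) (metis abs_ge_self abs_mult)
  also have "\<dots> \<le> enorm d x * enorm d y"
    unfolding enorm_def by (rule L2_set_mult_ineq)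
  finally show ?thesis .
qed

lemma coord_le_enorm: "i < d \<Longrightarrow> \<bar>x i\<bar> \<le> enorm d x"
proof -
  assume "i < d"
  then have "(x i)\<^sup>2 \<le> (\<Sum>j<d. (x j)\<^sup>2)"
    by (intro member_le_sum) auto
  then show ?thesis
    unfolding enorm_def L2_set_def by (metis real_sqrt_abs real_sqrt_le_iff)
qed

section \<open>Smooth convex functions: tangent bounds, quadratic bounds, continuity\<close>

lemma has_gradient_imp_directional_derivative:
  assumes "has_gradient d f (x + t *\<^sub>R v) u" "v \<in> Rd d"
  shows "((\<lambda>t. f (x + t *\<^sub>R v)) has_real_derivative einner d u v) (at t)"
  unfolding DERIV_def
proof (rule LIM_I)
  fix e :: real assume e: "0 < e"
  \<comment> \<open>The summand 1 covers \<open>enorm d v = 0\<close> and makes the final bound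
    \<open>e' * enorm d v < e\<close> strict.\<close>
  define e' where "e' = e / (enorm d v + 1)"
  have pos: "0 < enorm d v + 1"
    using enorm_nonneg[of d v] by linarith
  then have "0 < e'"
    using e by (simp add: e'_def)
  then obtain r where r: "0 < r"
    "\<And>h. h \<in> Rd d \<Longrightarrow> enorm d h < r \<Longrightarrow>
      \<bar>f (x + t *\<^sub>R v + h) - f (x + t *\<^sub>R v) - einner d u h\<bar> \<le> e' * enorm d h"
    using assms(1) unfolding has_gradient_def by blast
  have "norm ((f (x + (t + h) *\<^sub>R v) - f (x + t *\<^sub>R v)) / h - einner d u v) < e"
    if h: "h \<noteq> 0" "norm (h - 0) < r / (enorm d v + 1)" for h
  proof -
    have "\<bar>h\<bar> * enorm d v \<le> \<bar>h\<bar> * (enorm d v + 1)"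
      by (simp add: distrib_left)
    also have "\<dots> < r"
      using h pos by (simp add: field_simps)
    finally have "enorm d (h *\<^sub>R v) < r"
      by (simp add: enorm_scaleR)
    then have "\<bar>f (x + t *\<^sub>R v + h *\<^sub>R v) - f (x + t *\<^sub>R v) - einner d u (h *\<^sub>R v)\<bar> \<le> e' * (\<bar>h\<bar> * enorm d v)"
      using r(2)[of "h *\<^sub>R v"] assms(2) by (simp add: enorm_scaleR)
    then have "\<bar>f (x + (t + h) *\<^sub>R v) - f (x + t *\<^sub>R v) - h * einner d u v\<bar> \<le> \<bar>h\<bar> * (e' * enorm d v)"
      by (simp add: einner_simps scaleR_add_left add.assoc mult_ac)
    moreover have "(f (x + (t + h) *\<^sub>R v) - f (x + t *\<^sub>R v)) / h - einner d u v
        = (f (x + (t + h) *\<^sub>R v) - f (x + t *\<^sub>R v) - h * einner d u v) / h"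
      using h by (simp add: field_simps)
    ultimately have "norm ((f (x + (t + h) *\<^sub>R v) - f (x + t *\<^sub>R v)) / h - einner d u v) \<le> e' * enorm d v"
      using h by (simp add: abs_divide pos_divide_le_eq mult.commute)
    also have "\<dots> < e"
      using e pos by (simp add: e'_def field_simps)
    finally show ?thesis .
  qed
  then show "\<exists>s>0. \<forall>h. h \<noteq> 0 \<and> norm (h - 0) < s \<longrightarrow>
      norm ((f (x + (t + h) *\<^sub>R v) - f (x + t *\<^sub>R v)) / h - einner d u v) < e"
    using r(1) pos by (intro exI[of _ "r / (enorm d v + 1)"]) simp
qed

locale smooth_convex =
  fixes d :: nat and f :: "rvec \<Rightarrow> real" and G :: "rvec \<Rightarrow> rvec" and L :: real
  assumes convex: "convex_on (Rd d) f"
    and grad: "x \<in> Rd d \<Longrightarrow> has_gradient d f x (G x)"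
    and L_pos: "0 < L"
    and lipschitz: "x \<in> Rd d \<Longrightarrow> y \<in> Rd d \<Longrightarrow> enorm d (G x - G y) \<le> L * enorm d (x - y)"
begin

lemma G_Rd [simp]: "x \<in> Rd d \<Longrightarrow> G x \<in> Rd d"
  using grad by (auto simp: has_gradient_def)

lemma directional_derivative:
  assumes "x \<in> Rd d" "v \<in> Rd d"
  shows "((\<lambda>t. f (x + t *\<^sub>R v)) has_real_derivative einner d (G (x + t *\<^sub>R v)) v) (at t)"
  using assms by (intro has_gradient_imp_directional_derivative grad) auto

text \<open>On the line through \<open>x\<close> and \<open>y\<close> the function is a convex
  function of one real variable, whose tangent at 0 lies below its value at 1.\<close>

lemma above_tangent:
  assumes x: "x \<in> Rd d" and y: "y \<in> Rd d"
  shows "f x + einner d (G x) (y - x) \<le> f y"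
proof -
  define h where "h t = f (x + t *\<^sub>R (y - x))" for t
  have "convex_on UNIV h"
  proof (rule convex_onI)
    fix t s s' :: real assume "0 < t" "t < 1"
    then have "f ((1 - t) *\<^sub>R (x + s *\<^sub>R (y - x)) + t *\<^sub>R (x + s' *\<^sub>R (y - x)))
        \<le> (1 - t) * h s + t * h s'"
      unfolding h_def using x y by (intro convex_onD[OF convex]) auto
    moreover have "(1 - t) *\<^sub>R (x + s *\<^sub>R (y - x)) + t *\<^sub>R (x + s' *\<^sub>R (y - x))
        = x + ((1 - t) *\<^sub>R s + t *\<^sub>R s') *\<^sub>R (y - x)"
      by (simp add: fun_eq_iff algebra_simps)
    ultimately show "h ((1 - t) *\<^sub>R s + t *\<^sub>R s') \<le> (1 - t) * h s + t * h s'"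
      by (simp add: h_def)
  qed auto
  moreover have "(h has_real_derivative einner d (G (x + 0 *\<^sub>R (y - x))) (y - x)) (at 0)"
    unfolding h_def by (rule directional_derivative) (use x y in auto)
  ultimately have "einner d (G (x + 0 *\<^sub>R (y - x))) (y - x) * (1 - 0) \<le> h 1 - h 0"
    by (intro convex_on_imp_above_tangent[where A = UNIV]) auto
  then show ?thesis
    by (simp add: h_def)
qed

text \<open>Along the segment, \<open>f\<close> minus its quadratic model has a nonpositive
  derivative: Cauchy-Schwarz and the Lipschitz bound limit the growth of the slope to
  \<open>L * t * einner d v v\<close>.\<close>

lemma descent:
  assumes x: "x \<in> Rd d" and v: "v \<in> Rd d"
  shows "f (x + v) \<le> f x + einner d (G x) v + L / 2 * einner d v v"
proof -
  define h where "h t = f (x + t *\<^sub>R v) - (t * einner d (G x) v + L / 2 * t\<^sup>2 * einner d v v)" for t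
  have "h 1 \<le> h 0"
  proof (rule DERIV_nonpos_imp_nonincreasing[of 0 1 h])
    fix t :: real assume t: "0 \<le> t" "t \<le> 1"
    let ?D = "einner d (G (x + t *\<^sub>R v)) v - (einner d (G x) v + L * t * einner d v v)"
    have "(h has_real_derivative ?D) (at t)"
      unfolding h_def
      by (rule DERIV_diff[OF directional_derivative[OF x v]]) (auto intro!: derivative_eq_intros)
    moreover have "einner d (G (x + t *\<^sub>R v) - G x) v \<le> (L * (t * enorm d v)) * enorm d v"
      using lipschitz[of "x + t *\<^sub>R v" x] x v t
      by (intro order_trans[OF einner_le_enorm] mult_right_mono) (auto simp: enorm_scaleR)
    then have "?D \<le> 0"
      by (simp add: einner_simps power2_eq_square mult_ac flip: enorm_sq)
    ultimately show "\<exists>D. (h has_real_derivative D) (at t) \<and> D \<le> 0"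
      by blast
  qed simp
  then show ?thesis
    by (simp add: h_def)
qed

lemma continuous_on_enorm_diff: "continuous_on S (\<lambda>x. enorm d (x - a))"
  unfolding enorm_def L2_set_def
  by (auto intro!: continuous_intros continuous_on_subset[OF continuous_on_product_coordinates])

text \<open>Serves measurability. The topology is the product one, so coordinates are treated
  separately: those below \<open>d\<close> are dominated by the Euclidean Lipschitz bound, the
  others are constantly 0.\<close>

lemma continuous_G: "continuous_on (Rd d) G"
proof (rule continuous_on_coordinatewise_then_product)
  fix i
  show "continuous_on (Rd d) (\<lambda>x. G x i)"
  proof (cases "i < d")
    case True
    show ?thesis
      unfolding continuous_on_def
    proof (intro ballI)
      fix a assume a: "a \<in> Rd d"
      have "((\<lambda>x. L * enorm d (x - a)) \<longlongrightarrow> L * enorm d (a - a)) (at a within Rd d)"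
        using continuous_on_enorm_diff[of "Rd d" a] a
        by (intro tendsto_intros) (auto simp: continuous_on_def)
      then have "((\<lambda>x. L * enorm d (x - a)) \<longlongrightarrow> 0) (at a within Rd d)"
        by (simp add: enorm_def L2_set_def)
      moreover have "\<forall>\<^sub>F x in at a within Rd d. norm (G x i - G a i) \<le> L * enorm d (x - a)"
        unfolding eventually_at_filter
        using coord_le_enorm[OF True, of "G _ - G a"] lipschitz[OF _ a]
        by (intro always_eventually) (force intro: order_trans)
      ultimately have "((\<lambda>x. G x i - G a i) \<longlongrightarrow> 0) (at a within Rd d)"
        by (rule Lim_null_comparison[rotated])
      then show "((\<lambda>x. G x i) \<longlongrightarrow> G a i) (at a within Rd d)"
        by (simp add: LIM_zero_iff)
    qed
  next
    case False
    then have "continuous_on (Rd d) (\<lambda>x. G x i) \<longleftrightarrow> continuous_on (Rd d) (\<lambda>x. 0::real)"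
      using G_Rd by (intro continuous_on_cong) (auto simp: Rd_def)
    then show ?thesis
      by simp
  qed
qed

text \<open>Serves measurability. \<open>above_tangent\<close> controls \<open>f a - f x\<close> and
  \<open>descent\<close> controls \<open>f x - f a\<close>.\<close>

lemma continuous_f: "continuous_on (Rd d) f"
  unfolding continuous_on_def
proof (intro ballI)
  fix a assume a: "a \<in> Rd d"
  have lim: "((\<lambda>x. enorm d (x - a)) \<longlongrightarrow> 0) (at a within Rd d)"
    using continuous_on_enorm_diff[of "Rd d" a] a
    by (auto simp: continuous_on_def enorm_def L2_set_def)
  have "((\<lambda>x. enorm d (G a) * enorm d (x - a) + L / 2 * (enorm d (x - a))\<^sup>2)
      \<longlongrightarrow> enorm d (G a) * 0 + L / 2 * 0\<^sup>2) (at a within Rd d)"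
    by (intro tendsto_intros lim)
  then have "((\<lambda>x. enorm d (G a) * enorm d (x - a) + L / 2 * (enorm d (x - a))\<^sup>2)
      \<longlongrightarrow> 0) (at a within Rd d)"
    by simp
  moreover have "norm (f x - f a) \<le> enorm d (G a) * enorm d (x - a) + L / 2 * (enorm d (x - a))\<^sup>2"
    if x: "x \<in> Rd d" for x
  proof -
    have "f a - f x \<le> enorm d (G a) * enorm d (x - a)"
      using above_tangent[OF a x] einner_le_enorm[of d "G a" "a - x"] enorm_scaleR[of d "-1" "x - a"]
      by (simp add: einner_simps)
    moreover have "0 \<le> L / 2 * (enorm d (x - a))\<^sup>2"
      using L_pos by simp
    moreover have "f x - f a \<le> enorm d (G a) * enorm d (x - a) + L / 2 * (enorm d (x - a))\<^sup>2"
      using descent[of a "x - a"] a x einner_le_enorm[of d "G a" "x - a"] by (simp add: enorm_sq)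
    ultimately show ?thesis
      by (auto simp: abs_le_iff)
  qed
  then have "\<forall>\<^sub>F x in at a within Rd d.
      norm (f x - f a) \<le> enorm d (G a) * enorm d (x - a) + L / 2 * (enorm d (x - a))\<^sup>2"
    unfolding eventually_at_filter by (intro always_eventually) auto
  ultimately have "((\<lambda>x. f x - f a) \<longlongrightarrow> 0) (at a within Rd d)"
    by (rule Lim_null_comparison[rotated])
  then show "(f \<longlongrightarrow> f a) (at a within Rd d)"
    by (simp add: LIM_zero_iff)
qed

lemma gradient_at_minimizer:
  assumes m: "m \<in> Rd d" and min: "\<And>y. y \<in> Rd d \<Longrightarrow> f m \<le> f y" and v: "v \<in> Rd d"
  shows "einner d (G m) v = 0"
  using directional_derivative[OF m v, of 0] min m v
  by (intro DERIV_local_min[where f = "\<lambda>t. f (m + t *\<^sub>R v)" and x = 0 and d = 1]) auto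

text \<open>The tangent at \<open>x\<close> and the quadratic bound at \<open>m\<close> are compared
  at \<open>m + w\<close>, where the linear term of the latter vanishes because \<open>m\<close> is
  a minimizer. The surplus over plain convexity becomes \<open>gain\<close>.\<close>

lemma above_tangent_at_minimizer:
  assumes x: "x \<in> Rd d" and m: "m \<in> Rd d" and min: "\<And>y. y \<in> Rd d \<Longrightarrow> f m \<le> f y"
  shows "f x + einner d (G x) (m - x) + einner d (G x) (G x) / (2 * L) \<le> f m"
proof -
  \<comment> \<open>This \<open>w\<close> maximizes
    \<open>einner d (G x) w - L / 2 * einner d w w\<close>.\<close>
  define w where "w = (1 / L) *\<^sub>R G x"
  have w: "w \<in> Rd d"
    using x by (simp add: w_def)
  have "f x + einner d (G x) (m + w - x) \<le> f m + L / 2 * einner d w w"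
    using above_tangent[of x "m + w"] descent[OF m w] gradient_at_minimizer[OF m min w] x m w by simp
  then show ?thesis
    using L_pos by (simp add: w_def einner_simps diff_divide_distrib)
qed

end

section \<open>Measurability of vector operations on \<open>Rd d\<close>\<close>

lemma space_Rd_borel [simp]: "space (Rd_borel d) = Rd d"
  by (simp add: Rd_borel_def space_restrict_space)

lemma measurable_Rd_coord [measurable]: "(\<lambda>x. x i) \<in> borel_measurable (Rd_borel d)"
  unfolding Rd_borel_def
  by (intro borel_measurable_continuous_on_restrict continuous_on_subset[OF continuous_on_product_coordinates]) simp

text \<open>The Borel sets of the countable product are generated by the coordinates.\<close>

lemma measurable_Rd_borelI:
  assumes "\<And>w. w \<in> space M \<Longrightarrow> h w \<in> Rd d" "\<And>i. (\<lambda>w. h w i) \<in> borel_measurable M"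
  shows "h \<in> M \<rightarrow>\<^sub>M Rd_borel d"
  unfolding Rd_borel_def using assms
  by (intro measurable_restrict_space2 measurable_coordinatewise_then_product) auto

lemma measurable_Rd_apply:
  "h \<in> M \<rightarrow>\<^sub>M Rd_borel d \<Longrightarrow> (\<lambda>w. h w i) \<in> borel_measurable M"
  by (rule measurable_compose[OF _ measurable_Rd_coord])

lemma measurable_Rd_add [measurable]:
  assumes h: "h \<in> M \<rightarrow>\<^sub>M Rd_borel d" and h': "h' \<in> M \<rightarrow>\<^sub>M Rd_borel d"
  shows "(\<lambda>w. h w + h' w) \<in> M \<rightarrow>\<^sub>M Rd_borel d"
  using measurable_space[OF h] measurable_space[OF h'] measurable_Rd_apply[OF h] measurable_Rd_apply[OF h']
  by (intro measurable_Rd_borelI) auto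

lemma measurable_Rd_scaleR [measurable]:
  assumes h: "h \<in> M \<rightarrow>\<^sub>M Rd_borel d"
  shows "(\<lambda>w. a *\<^sub>R h w) \<in> M \<rightarrow>\<^sub>M Rd_borel d"
  using measurable_space[OF h] measurable_Rd_apply[OF h]
  by (intro measurable_Rd_borelI) auto

lemma measurable_Rd_diff [measurable]:
  assumes h: "h \<in> M \<rightarrow>\<^sub>M Rd_borel d" and h': "h' \<in> M \<rightarrow>\<^sub>M Rd_borel d"
  shows "(\<lambda>w. h w - h' w) \<in> M \<rightarrow>\<^sub>M Rd_borel d"
  using measurable_space[OF h] measurable_space[OF h'] measurable_Rd_apply[OF h] measurable_Rd_apply[OF h']
  by (intro measurable_Rd_borelI) auto

lemma measurable_einner [measurable]:
  assumes "h \<in> M \<rightarrow>\<^sub>M Rd_borel d" "h' \<in> M \<rightarrow>\<^sub>M Rd_borel d"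
  shows "(\<lambda>w. einner d (h w) (h' w)) \<in> borel_measurable M"
  using measurable_Rd_apply[OF assms(1)] measurable_Rd_apply[OF assms(2)]
  unfolding einner_def by measurable

lemma (in smooth_convex) measurable_f [measurable]: "f \<in> borel_measurable (Rd_borel d)"
  unfolding Rd_borel_def by (intro borel_measurable_continuous_on_restrict continuous_f)

lemma (in smooth_convex) measurable_G [measurable]: "G \<in> Rd_borel d \<rightarrow>\<^sub>M Rd_borel d"
  using borel_measurable_continuous_on_restrict[OF continuous_G] G_Rd
  unfolding Rd_borel_def by (intro measurable_restrict_space2) (auto simp: space_restrict_space)

section \<open>Second moment of a compressed vector\<close>

lemma compression_operator_kernel:
  "compression_operator d \<omega> C \<Longrightarrow> C \<in> Rd_borel d \<rightarrow>\<^sub>M prob_algebra (Rd_borel d)"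
  by (simp add: compression_operator_def)

text \<open>The expansion \<open>\<parallel>g\<parallel>\<^sup>2 = \<parallel>g - u\<parallel>\<^sup>2 + 2\<langle>u, g\<rangle> - \<parallel>u\<parallel>\<^sup>2\<close> gives \<open>E \<parallel>g\<parallel>\<^sup>2 \<le> (1 + \<omega>) \<parallel>u\<parallel>\<^sup>2\<close> for \<open>g\<close> drawn from \<open>C u\<close>.\<close>

lemma compression_operator_quadratic_bound:
  assumes C: "compression_operator d \<omega> C" and u: "u \<in> Rd d" and b: "0 \<le> b"
    and h: "\<And>g. g \<in> Rd d \<Longrightarrow> 0 \<le> h g \<and> h g \<le> a + einner d w g + b * einner d g g"
  defines "B \<equiv> a + einner d w u + b * (1 + \<omega>) * einner d u u"
  shows "0 \<le> B" "(\<integral>\<^sup>+g. ennreal (h g) \<partial>C u) \<le> ennreal B"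
proof -
  have Cu: "prob_space (C u)" "sets (C u) = sets (Rd_borel d)"
    using measurable_space[OF compression_operator_kernel[OF C]] u
    by (auto simp: space_prob_algebra)
  then interpret prob_space "C u" by simp
  have sp: "space (C u) = Rd d"
    using sets_eq_imp_space_eq[OF Cu(2)] by simp
  have coord: "integrable (C u) (\<lambda>g. g i)" "(\<integral>g. g i \<partial>C u) = u i" if "i < d" for i
    using C u that by (auto simp: compression_operator_def)
  have lin: "integrable (C u) (\<lambda>g. einner d v g)" "(\<integral>g. einner d v g \<partial>C u) = einner d v u" for v
    unfolding einner_def using coord by auto
  have var: "integrable (C u) (\<lambda>g. (enorm d (g - u))\<^sup>2)"
    "(\<integral>g. (enorm d (g - u))\<^sup>2 \<partial>C u) \<le> \<omega> * einner d u u"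
    using C u by (auto simp: compression_operator_def enorm_sq)
  \<comment> \<open>The operator is assumed to have an integrable squared deviation, so the
    quadratic majorant is written through \<open>g - u\<close>; the next fact identifies the two
    forms.\<close>
  define q where "q g = a + einner d w g + b * ((enorm d (g - u))\<^sup>2 + 2 * einner d u g - einner d u u)" for g
  have q: "q g = a + einner d w g + b * einner d g g" for g
    unfolding q_def by (simp add: enorm_sq einner_simps einner_commute[of d g u])
  have int: "integrable (C u) q"
    unfolding q_def using lin(1) var(1) by auto
  have nonneg: "0 \<le> q g" if "g \<in> Rd d" for g
    using h[OF that] by (simp add: q)
  have "(\<integral>g. q g \<partial>C u)
      = a + einner d w u + b * ((\<integral>g. (enorm d (g - u))\<^sup>2 \<partial>C u) + einner d u u)"
    unfolding q_def using lin var(1) by (simp add: prob_space)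
  also have "\<dots> \<le> B"
    using mult_left_mono[OF var(2) b] by (simp add: B_def algebra_simps)
  finally have le: "(\<integral>g. q g \<partial>C u) \<le> B" .
  \<comment> \<open>The sign of \<open>B\<close> matters because \<open>ennreal\<close> sends
    negative numbers to 0, which would break additivity later.\<close>
  have "0 \<le> (\<integral>g. q g \<partial>C u)"
    using nonneg by (intro integral_nonneg_AE) (auto simp: sp)
  with le show "0 \<le> B"
    by simp
  have "(\<integral>\<^sup>+g. ennreal (h g) \<partial>C u) \<le> (\<integral>\<^sup>+g. ennreal (q g) \<partial>C u)"
    using h by (intro nn_integral_mono ennreal_leI) (auto simp: sp q)
  also have "\<dots> = ennreal (\<integral>g. q g \<partial>C u)"
    using int nonneg by (intro nn_integral_eq_integral) (auto simp: sp)
  also have "\<dots> \<le> ennreal B"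
    using le by (rule ennreal_leI)
  finally show "(\<integral>\<^sup>+g. ennreal (h g) \<partial>C u) \<le> ennreal B" .
qed

section \<open>ACGD as a Markov chain on pairs \<open>(y, z)\<close>\<close>

locale acgd_run = smooth_convex +
  fixes \<omega> :: real and C :: "rvec \<Rightarrow> rvec measure" and x0 xs :: rvec and p :: real
  assumes minimizer: "xs \<in> Rd d" "x \<in> Rd d \<Longrightarrow> f xs \<le> f x"
    and omega_nonneg: "0 \<le> \<omega>"
    and compression: "compression_operator d \<omega> C"
    and x0: "x0 \<in> Rd d"
    and p_def: "p = 1 + \<omega>"
begin

abbreviation BB :: "(rvec \<times> rvec) measure" where
  "BB \<equiv> Rd_borel d \<Otimes>\<^sub>M Rd_borel d"

abbreviation S :: "nat \<Rightarrow> (rvec \<times> rvec) measure" where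
  "S \<equiv> acgd_state d C G (\<lambda>k. 1 / L) (\<lambda>k. real k / (real k + 2)) (\<lambda>k. 0) (\<lambda>k. 2 * p / (real k + 2)) p x0"

abbreviation X :: "nat \<Rightarrow> rvec measure" where
  "X \<equiv> acgd_iterate d C G (\<lambda>k. 1 / L) (\<lambda>k. real k / (real k + 2)) (\<lambda>k. 0) (\<lambda>k. 2 * p / (real k + 2)) p x0"

text \<open>The iterate \<open>x\<^sup>k\<close> as a function of the state
  \<open>(y\<^sup>k, z\<^sup>k)\<close>.\<close>

definition mix :: "nat \<Rightarrow> rvec \<times> rvec \<Rightarrow> rvec" where
  "mix k q = (real k / (real k + 2)) *\<^sub>R fst q + (2 / (real k + 2)) *\<^sub>R snd q"

text \<open>The effective step length of \<open>z\<close>: the factor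
  \<open>(k + 2) / (2 * p)\<close>, which is \<open>1 / \<gamma>\<^sub>k\<close>, times the step
  length \<open>1 / (L * p)\<close> of \<open>y\<close>.\<close>

definition \<alpha> :: "nat \<Rightarrow> real" where
  "\<alpha> k = (real k + 2) / (2 * L * p\<^sup>2)"

definition step :: "nat \<Rightarrow> rvec \<times> rvec \<Rightarrow> rvec \<Rightarrow> rvec \<times> rvec" where
  "step k q g = (mix k q - (1 / (L * p)) *\<^sub>R g, snd q - \<alpha> k *\<^sub>R g)"

definition kernel :: "nat \<Rightarrow> rvec \<times> rvec \<Rightarrow> (rvec \<times> rvec) measure" where
  "kernel k q = C (G (mix k q)) \<bind> (\<lambda>g. return BB (step k q g))"

lemma p_ge_1: "1 \<le> p"
  using omega_nonneg by (simp add: p_def)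

lemma p_pos: "0 < p"
  using p_ge_1 by simp

lemma acgd_x_eq: "acgd_x (\<lambda>k. real k / (real k + 2)) k y z = mix k (y, z)"
proof -
  have "1 - real k / (real k + 2) = 2 / (real k + 2)"
    by (simp add: field_simps)
  then show ?thesis
    by (simp add: acgd_x_def mix_def)
qed

text \<open>The choice of \<open>\<gamma>\<^sub>k\<close> eliminates \<open>y\<close>: its
  coefficient is \<open>k / (2 * p) + 1 / p - (k + 2) / (2 * p) = 0\<close>, while that of
  \<open>z\<close> is \<open>1 / p + (1 - 1 / p) = 1\<close>.\<close>

lemma acgd_z_eq:
  "acgd_z (\<lambda>k. 0) (\<lambda>k. 2 * p / (real k + 2)) p k (mix k (y, z)) y z (mix k (y, z) - (1 / (L * p)) *\<^sub>R g)
    = z - \<alpha> k *\<^sub>R g"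
proof
  fix i
  show "acgd_z (\<lambda>k. 0) (\<lambda>k. 2 * p / (real k + 2)) p k (mix k (y, z)) y z (mix k (y, z) - (1 / (L * p)) *\<^sub>R g) i
    = (z - \<alpha> k *\<^sub>R g) i"
    using p_pos L_pos unfolding acgd_z_def mix_def \<alpha>_def
    by (simp add: divide_simps power2_eq_square) (simp add: algebra_simps)
qed

lemma S_Suc: "S (Suc k) = S k \<bind> kernel k"
proof -
  have "acgd_y (\<lambda>k. 1 / L) p k x g = x - (1 / (L * p)) *\<^sub>R g" for x g
    by (simp add: acgd_y_def)
  then show ?thesis
    unfolding acgd_state.simps Let_def acgd_x_eq
    by (simp add: acgd_z_eq kernel_def[abs_def] step_def case_prod_unfold)
qed

lemma measurable_mix [measurable]: "mix k \<in> BB \<rightarrow>\<^sub>M Rd_borel d"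
  unfolding mix_def by measurable

lemma measurable_step [measurable]: "(\<lambda>(q, g). step k q g) \<in> BB \<Otimes>\<^sub>M Rd_borel d \<rightarrow>\<^sub>M BB"
  unfolding step_def case_prod_unfold by measurable

lemma measurable_kernel [measurable]: "kernel k \<in> BB \<rightarrow>\<^sub>M prob_algebra BB"
  unfolding kernel_def[abs_def]
proof (rule measurable_bind_prob_space2)
  show "(\<lambda>q. C (G (mix k q))) \<in> BB \<rightarrow>\<^sub>M prob_algebra (Rd_borel d)"
    by (rule measurable_compose[OF _ compression_operator_kernel[OF compression]]) measurable
  show "(\<lambda>(q, g). return BB (step k q g)) \<in> BB \<Otimes>\<^sub>M Rd_borel d \<rightarrow>\<^sub>M prob_algebra BB"
    using measurable_compose[OF measurable_step measurable_return_prob_space]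
    by (simp add: case_prod_unfold)
qed

lemma S_prob_algebra: "S k \<in> space (prob_algebra BB)"
proof (induction k)
  case 0
  show ?case
    using x0 by (auto simp: space_prob_algebra space_pair_measure intro!: prob_space_return)
next
  case (Suc k)
  then have "prob_space (S k \<bind> kernel k)" "sets (S k \<bind> kernel k) = sets BB"
    by (rule prob_space_bind'[OF _ measurable_kernel] sets_bind'[OF _ measurable_kernel])+
  then show ?case
    by (simp add: S_Suc space_prob_algebra del: acgd_state.simps)
qed

lemma sets_S [measurable_cong]: "sets (S k) = sets BB"
  and prob_space_S: "prob_space (S k)"
  using S_prob_algebra[of k] by (auto simp: space_prob_algebra)

lemma space_S: "space (S k) = Rd d \<times> Rd d"
  using sets_eq_imp_space_eq[OF sets_S[of k]] by (simp add: space_pair_measure)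

lemma mix_Rd [simp]: "q \<in> Rd d \<times> Rd d \<Longrightarrow> mix k q \<in> Rd d"
  by (auto simp: mix_def)

text \<open>The tower property: first average over the fresh draw, then over the state. Nonnegative
  integrals avoid integrability conditions along the chain.\<close>

lemma nn_integral_S_Suc:
  assumes h [measurable]: "h \<in> borel_measurable BB"
  shows "(\<integral>\<^sup>+q. h q \<partial>S (Suc k)) = (\<integral>\<^sup>+q. (\<integral>\<^sup>+g. h (step k q g) \<partial>C (G (mix k q))) \<partial>S k)"
proof -
  have kernel: "(\<integral>\<^sup>+q'. h q' \<partial>kernel k q) = (\<integral>\<^sup>+g. h (step k q g) \<partial>C (G (mix k q)))"
    if q: "q \<in> Rd d \<times> Rd d" for q
  proof -
    have Cq: "sets (C (G (mix k q))) = sets (Rd_borel d)"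
      using measurable_space[OF compression_operator_kernel[OF compression], of "G (mix k q)"] q
      by (auto simp: space_prob_algebra)
    have step: "step k q \<in> Rd_borel d \<rightarrow>\<^sub>M BB"
      using measurable_Pair2[OF measurable_step, of q k] q by (simp add: space_pair_measure)
    have "(\<lambda>g. return BB (step k q g)) \<in> C (G (mix k q)) \<rightarrow>\<^sub>M subprob_algebra BB"
      unfolding measurable_cong_sets[OF Cq refl]
      by (rule measurable_compose[OF step return_measurable])
    then have "(\<integral>\<^sup>+q'. h q' \<partial>kernel k q)
        = (\<integral>\<^sup>+g. (\<integral>\<^sup>+q'. h q' \<partial>return BB (step k q g)) \<partial>C (G (mix k q)))"
      unfolding kernel_def by (rule nn_integral_bind[OF h])
    also have "\<dots> = (\<integral>\<^sup>+g. h (step k q g) \<partial>C (G (mix k q)))"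
    proof (rule nn_integral_cong)
      fix g assume "g \<in> space (C (G (mix k q)))"
      then have g: "g \<in> Rd d"
        using sets_eq_imp_space_eq[OF Cq] by simp
      have "snd q \<in> Rd d"
        using q by auto
      then have "step k q g \<in> space BB"
        unfolding step_def space_pair_measure using g mix_Rd[OF q, of k] by simp
      then show "(\<integral>\<^sup>+q'. h q' \<partial>return BB (step k q g)) = h (step k q g)"
        using h by (rule nn_integral_return)
    qed
    finally show ?thesis .
  qed
  have "(\<integral>\<^sup>+q. h q \<partial>S (Suc k)) = (\<integral>\<^sup>+q. (\<integral>\<^sup>+q'. h q' \<partial>kernel k q) \<partial>S k)"
    unfolding S_Suc
    using measurable_prob_algebraD[OF measurable_kernel] measurable_cong_sets[OF sets_S refl]
    by (intro nn_integral_bind[OF h]) simp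
  also have "\<dots> = (\<integral>\<^sup>+q. (\<integral>\<^sup>+g. h (step k q g) \<partial>C (G (mix k q))) \<partial>S k)"
    by (rule nn_integral_cong) (rule kernel, simp add: space_S)
  finally show ?thesis .
qed

section \<open>The potential and its expected decrease\<close>

text \<open>The objective has weight 0 at \<open>k = 0\<close>, so the initial potential is half the
  squared distance to \<open>xs\<close>.\<close>

definition potential :: "nat \<Rightarrow> rvec \<times> rvec \<Rightarrow> real" where
  "potential k q = \<alpha> k * (real k / 2) * (f (fst q) - f xs) + einner d (snd q - xs) (snd q - xs) / 2"

definition gain :: "nat \<Rightarrow> rvec \<times> rvec \<Rightarrow> real" where
  "gain k q = \<alpha> k / (2 * L) * einner d (G (mix k q)) (G (mix k q))"

lemma \<alpha>_pos: "0 < \<alpha> k"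
  using L_pos p_pos by (simp add: \<alpha>_def add_nonneg_pos)

lemma potential_nonneg: "q \<in> Rd d \<times> Rd d \<Longrightarrow> 0 \<le> potential k q"
  using \<alpha>_pos[of k] minimizer(2)[of "fst q"]
  by (auto simp: potential_def intro!: add_nonneg_nonneg mult_nonneg_nonneg)

lemma gain_nonneg: "0 \<le> gain k q"
  using \<alpha>_pos[of k] L_pos by (simp add: gain_def)

lemma measurable_potential [measurable]: "potential k \<in> borel_measurable BB"
proof -
  have "(\<lambda>q. snd q - xs) \<in> BB \<rightarrow>\<^sub>M Rd_borel d"
    using minimizer(1) by (intro measurable_Rd_diff) auto
  moreover have "(\<lambda>q. f (fst q)) \<in> borel_measurable BB"
    by (rule measurable_compose[OF measurable_fst measurable_f])
  ultimately show ?thesis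
    unfolding potential_def[abs_def] by (intro borel_measurable_add borel_measurable_times
      borel_measurable_diff borel_measurable_divide measurable_einner) auto
qed

lemma measurable_gain [measurable]: "gain k \<in> borel_measurable BB"
  unfolding gain_def[abs_def] by measurable

lemma einner_mix:
  "(real k + 2) * einner d u (mix k q) = real k * einner d u (fst q) + 2 * einner d u (snd q)"
  by (simp add: mix_def einner_simps divide_simps)

text \<open>The tangent inequality at \<open>mix k q\<close> is used towards \<open>xs\<close> (with
  its surplus) with weight 1 and towards \<open>fst q\<close> with weight \<open>k / 2\<close>. By
  \<open>einner_mix\<close> the linear terms add up to
  \<open>einner d u (xs - snd q)\<close>.\<close>

lemma coupling:
  assumes q: "q \<in> Rd d \<times> Rd d"
  shows "\<alpha> k * ((real k + 2) / 2) * (f (mix k q) - f xs)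
      + einner d (snd q - xs) (snd q - xs) / 2 - \<alpha> k * einner d (G (mix k q)) (snd q - xs)
      + gain k q \<le> potential k q"
proof -
  define m u where "m = mix k q" and "u = G m"
  define e where "e = einner d u u / (2 * L)"
  have m: "m \<in> Rd d" and y: "fst q \<in> Rd d"
    using q by (auto simp: m_def)
  have 1: "f m + einner d u (xs - m) + einner d u u / (2 * L) \<le> f xs"
    unfolding u_def by (intro above_tangent_at_minimizer m minimizer)
  have 2: "real k * (f m + einner d u (fst q - m)) \<le> real k * f (fst q)"
    unfolding u_def using above_tangent[OF m y] by (intro mult_left_mono) auto
  have "(real k + 2) / 2 * (f m - f xs) - einner d u (snd q - xs) + einner d u u / (2 * L)
      \<le> real k / 2 * (f (fst q) - f xs)"
    using 1 2 einner_mix[of k u q] unfolding m_def[symmetric] e_def[symmetric]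
    by (simp add: einner_simps algebra_simps add_divide_distrib diff_divide_distrib)
  from mult_left_mono[OF this less_imp_le[OF \<alpha>_pos[of k]]]
  have "\<alpha> k * ((real k + 2) / 2) * (f m - f xs) - \<alpha> k * einner d u (snd q - xs) + gain k q
      \<le> \<alpha> k * (real k / 2) * (f (fst q) - f xs)"
    by (simp add: gain_def m_def u_def algebra_simps add_divide_distrib diff_divide_distrib)
  then show ?thesis
    unfolding potential_def m_def u_def by linarith
qed

text \<open>By \<open>descent\<close>, the new potential is at most a quadratic polynomial in
  \<open>g\<close>. Averaging replaces \<open>g\<close> by \<open>u\<close> at the cost of a factor
  \<open>1 + \<omega>\<close> on the quadratic term; after cancellation of
  \<open>einner d u u\<close>, \<open>coupling\<close> applies.\<close>

lemma one_step:
  assumes q: "q \<in> Rd d \<times> Rd d"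
  shows "(\<integral>\<^sup>+g. ennreal (potential (Suc k) (step k q g)) \<partial>C (G (mix k q))) + ennreal (gain k q)
    \<le> ennreal (potential k q)"
proof -
  define m u z A where "m = mix k q" and "u = G m" and "z = snd q - xs"
    and "A = \<alpha> k * ((real k + 2) / 2)"
  define a w b where "a = A * (f m - f xs) + einner d z z / 2"
    and "w = (- (A / (L * p))) *\<^sub>R u - \<alpha> k *\<^sub>R z" and "b = A / (2 * L * p\<^sup>2) + (\<alpha> k)\<^sup>2 / 2"
  have m: "m \<in> Rd d" and u: "u \<in> Rd d" and z: "z \<in> Rd d"
    using q minimizer(1) by (auto simp: m_def u_def z_def)
  have A: "0 \<le> A"
    using \<alpha>_pos[of k] by (simp add: A_def)
  have b: "0 \<le> b"
    using A L_pos by (simp add: b_def)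
  \<comment> \<open>Amounts to \<open>(k + 3) * (k + 1) \<le> (k + 2)\<^sup>2\<close>.\<close>
  have A_Suc: "\<alpha> (Suc k) * (real (Suc k) / 2) \<le> A"
    using L_pos p_pos by (simp add: A_def \<alpha>_def divide_simps) (simp add: algebra_simps)
  have "0 \<le> potential (Suc k) (step k q g) \<and>
      potential (Suc k) (step k q g) \<le> a + einner d w g + b * einner d g g" if g: "g \<in> Rd d" for g
  proof
    have y': "m - (1 / (L * p)) *\<^sub>R g \<in> Rd d"
      using m g by simp
    then show "0 \<le> potential (Suc k) (step k q g)"
      using q g by (intro potential_nonneg) (auto simp: step_def m_def)
    define c where "c = - (1 / (L * p))"
    have "m - (1 / (L * p)) *\<^sub>R g = m + c *\<^sub>R g"
      by (simp add: c_def)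
    then have "f (m - (1 / (L * p)) *\<^sub>R g)
        \<le> f m - einner d u g / (L * p) + L / 2 * (einner d g g / (L * p)\<^sup>2)"
      using descent[OF m, of "c *\<^sub>R g"] g L_pos
      by (simp add: einner_simps u_def power2_eq_square) (simp add: c_def)
    also have "L / 2 * (einner d g g / (L * p)\<^sup>2) = einner d g g / (2 * L * p\<^sup>2)"
      using L_pos by (simp add: power2_eq_square)
    finally have "A * (f (m - (1 / (L * p)) *\<^sub>R g) - f xs)
        \<le> A * (f m - einner d u g / (L * p) + einner d g g / (2 * L * p\<^sup>2) - f xs)"
      using A by (intro mult_left_mono diff_right_mono)
    note f = this
    have "\<alpha> (Suc k) * (real (Suc k) / 2) * (f (m - (1 / (L * p)) *\<^sub>R g) - f xs)
        \<le> A * (f (m - (1 / (L * p)) *\<^sub>R g) - f xs)"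
      using A_Suc minimizer(2)[OF y'] by (intro mult_right_mono) auto
    also note f
    finally have "potential (Suc k) (step k q g)
        \<le> A * (f m - einner d u g / (L * p) + einner d g g / (2 * L * p\<^sup>2) - f xs)
          + einner d (z - \<alpha> k *\<^sub>R g) (z - \<alpha> k *\<^sub>R g) / 2"
      by (simp add: potential_def step_def m_def z_def algebra_simps)
    also have "\<dots> = a + einner d w g + b * einner d g g"
      by (simp add: a_def w_def b_def einner_simps einner_commute[of d g z] power2_eq_square[of "\<alpha> k"])
        (simp add: algebra_simps add_divide_distrib diff_divide_distrib)
    finally show "potential (Suc k) (step k q g) \<le> a + einner d w g + b * einner d g g" .
  qed
  note bound = compression_operator_quadratic_bound[OF compression u b this]
  \<comment> \<open>Both summands of \<open>b\<close> equal \<open>(\<alpha> k)\<^sup>2 / 2\<close>.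
    The result is exactly the coefficient of \<open>u\<close> in \<open>- w\<close>, so the second
    moment of the compressed gradient cancels the decrease from the \<open>y\<close>-step.\<close>
  have b_eq: "b * (1 + \<omega>) = A / (L * p)"
    using L_pos p_pos unfolding p_def[symmetric]
    by (simp add: b_def A_def \<alpha>_def field_simps power2_eq_square)
  have "(\<integral>\<^sup>+g. ennreal (potential (Suc k) (step k q g)) \<partial>C (G (mix k q))) + ennreal (gain k q)
      \<le> ennreal (a + einner d w u + b * (1 + \<omega>) * einner d u u) + ennreal (gain k q)"
    using bound(2) unfolding u_def m_def by (rule add_right_mono)
  also have "\<dots> = ennreal (a + einner d w u + b * (1 + \<omega>) * einner d u u + gain k q)"
    using bound(1) gain_nonneg by simp
  also have "\<dots> = ennreal (A * (f m - f xs) + einner d z z / 2 - \<alpha> k * einner d u z + gain k q)"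
    unfolding b_eq by (simp add: a_def w_def einner_simps einner_commute[of d z u] algebra_simps)
  also have "\<dots> \<le> ennreal (potential k q)"
    unfolding A_def m_def u_def z_def by (intro ennreal_leI coupling q)
  finally show ?thesis .
qed

lemma expected_potential_step:
  "(\<integral>\<^sup>+q. ennreal (potential (Suc k) q) \<partial>S (Suc k)) + (\<integral>\<^sup>+q. ennreal (gain k q) \<partial>S k)
    \<le> (\<integral>\<^sup>+q. ennreal (potential k q) \<partial>S k)"
proof -
  define e where "e q = (\<integral>\<^sup>+g. ennreal (potential (Suc k) (step k q g)) \<partial>C (G (mix k q)))" for q
  have kernel: "(\<lambda>q. C (G (mix k q))) \<in> BB \<rightarrow>\<^sub>M subprob_algebra (Rd_borel d)"
    by (rule measurable_prob_algebraD)
      (rule measurable_compose[OF _ compression_operator_kernel[OF compression]], measurable)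
  have "(\<lambda>(q, g). ennreal (potential (Suc k) (step k q g))) \<in> borel_measurable (BB \<Otimes>\<^sub>M Rd_borel d)"
    using measurable_compose[OF measurable_step measurable_potential, of k "Suc k"]
    by (simp add: case_prod_unfold)
  then have e: "e \<in> borel_measurable BB"
    unfolding e_def[abs_def] using kernel by (rule nn_integral_measurable_subprob_algebra2)
  have "(\<integral>\<^sup>+q. ennreal (potential (Suc k) q) \<partial>S (Suc k)) + (\<integral>\<^sup>+q. ennreal (gain k q) \<partial>S k)
      = (\<integral>\<^sup>+q. e q \<partial>S k) + (\<integral>\<^sup>+q. ennreal (gain k q) \<partial>S k)"
    unfolding e_def by (subst nn_integral_S_Suc) auto
  also have "\<dots> = (\<integral>\<^sup>+q. e q + ennreal (gain k q) \<partial>S k)"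
    using e measurable_gain[of k] by (subst nn_integral_add) (auto simp: measurable_cong_sets[OF sets_S refl])
  also have "\<dots> \<le> (\<integral>\<^sup>+q. ennreal (potential k q) \<partial>S k)"
    unfolding e_def by (intro nn_integral_mono one_step) (simp add: space_S)
  finally show ?thesis .
qed

text \<open>Keeping the gains on the left lets one inequality bound both their sum and the potential
  at time \<open>n\<close>.\<close>

lemma expected_potential_telescope:
  "(\<Sum>k<n. \<integral>\<^sup>+q. ennreal (gain k q) \<partial>S k) + (\<integral>\<^sup>+q. ennreal (potential n q) \<partial>S n)
    \<le> ennreal ((enorm d (x0 - xs))\<^sup>2 / 2)"
proof (induction n)
  case 0
  have "(\<integral>\<^sup>+q. ennreal (potential 0 q) \<partial>S 0) = ennreal (potential 0 (x0, x0))"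
    unfolding acgd_state.simps
    by (rule nn_integral_return) (use x0 in \<open>auto simp: space_pair_measure\<close>)
  also have "potential 0 (x0, x0) = (enorm d (x0 - xs))\<^sup>2 / 2"
    by (simp add: potential_def enorm_sq)
  finally show ?case
    by (simp only: lessThan_0 sum.empty add_0 order_refl)
next
  case (Suc n)
  have "(\<Sum>k<Suc n. \<integral>\<^sup>+q. ennreal (gain k q) \<partial>S k) + (\<integral>\<^sup>+q. ennreal (potential (Suc n) q) \<partial>S (Suc n))
      = (\<Sum>k<n. \<integral>\<^sup>+q. ennreal (gain k q) \<partial>S k)
        + ((\<integral>\<^sup>+q. ennreal (potential (Suc n) q) \<partial>S (Suc n)) + (\<integral>\<^sup>+q. ennreal (gain n q) \<partial>S n))"
    by (simp add: add_ac del: acgd_state.simps)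
  also have "\<dots> \<le> (\<Sum>k<n. \<integral>\<^sup>+q. ennreal (gain k q) \<partial>S k) + (\<integral>\<^sup>+q. ennreal (potential n q) \<partial>S n)"
    by (intro add_left_mono expected_potential_step)
  also note Suc.IH
  finally show ?case .
qed

section \<open>From the potential to the objective at \<open>x\<^sup>k\<close>\<close>

text \<open>Young's inequality splits the inner product in \<open>coupling\<close>: one half is
  absorbed by the distance term, the other is \<open>\<alpha> k * L * gain k q\<close>.\<close>

lemma objective_at_mix:
  assumes q: "q \<in> Rd d \<times> Rd d"
  shows "(real k + 2)\<^sup>2 / (4 * L * p\<^sup>2) * (f (mix k q) - f xs) \<le> potential k q + \<alpha> k * L * gain k q"
proof -
  define u z where "u = G (mix k q)" and "z = snd q - xs"
  have "0 \<le> einner d (z - \<alpha> k *\<^sub>R u) (z - \<alpha> k *\<^sub>R u)"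
    by simp
  then have "\<alpha> k * einner d u z \<le> einner d z z / 2 + (\<alpha> k)\<^sup>2 / 2 * einner d u u"
    by (simp add: einner_simps einner_commute[of d z u] power2_eq_square[of "\<alpha> k"] algebra_simps)
  moreover have "\<alpha> k * L * gain k q = (\<alpha> k)\<^sup>2 / 2 * einner d u u"
    using L_pos by (simp add: gain_def u_def power2_eq_square)
  moreover have eq: "(real k + 2)\<^sup>2 / (4 * L * p\<^sup>2) = \<alpha> k * ((real k + 2) / 2)"
    by (simp add: \<alpha>_def power2_eq_square)
  ultimately show ?thesis
    using coupling[OF q, of k] gain_nonneg[of k q] unfolding eq u_def z_def by linarith
qed

lemma X_eq: "X k = distr (S k) (Rd_borel d) (mix k)"
  by (simp add: acgd_iterate_def acgd_x_eq case_prod_unfold)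

text \<open>Since \<open>f - f xs\<close> is nonnegative, a finite bound on its nonnegative integral
  yields integrability and the same bound for the Bochner integral.\<close>

lemma expected_objective:
  assumes le: "(\<integral>\<^sup>+q. ennreal (f (mix k q) - f xs) \<partial>S k) \<le> ennreal b" and b: "0 \<le> b"
  shows "integrable (X k) f \<and> (\<integral>x. f x \<partial>X k) - f xs \<le> b"
proof -
  have mix: "mix k \<in> S k \<rightarrow>\<^sub>M Rd_borel d"
    by (simp add: measurable_cong_sets[OF sets_S refl])
  interpret prob_space "X k"
    unfolding X_eq using mix by (intro prob_space.prob_space_distr prob_space_S)
  have meas: "(\<lambda>x. f x - f xs) \<in> borel_measurable (X k)"
    unfolding X_eq by measurable
  have nonneg: "AE x in X k. 0 \<le> f x - f xs"
    using minimizer(2) by (intro AE_I2) (simp add: X_eq)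
  have le': "(\<integral>\<^sup>+x. ennreal (f x - f xs) \<partial>X k) \<le> ennreal b"
    using le unfolding X_eq by (subst nn_integral_distr[OF mix]) measurable
  have int: "integrable (X k) (\<lambda>x. f x - f xs)"
    using le' by (intro integrableI_nonneg meas nonneg) (simp add: order_le_less_trans)
  have "ennreal (\<integral>x. f x - f xs \<partial>X k) \<le> ennreal b"
    using le' nn_integral_eq_integral[OF int nonneg] by simp
  then have "(\<integral>x. f x - f xs \<partial>X k) \<le> b"
    using b by simp
  moreover have "integrable (X k) f"
    using Bochner_Integration.integrable_add[OF int, of "\<lambda>x. f xs"] by simp
  ultimately show ?thesis
    by (simp add: prob_space)
qed

text \<open>Here \<open>x\<^sup>0\<close> is the deterministic point \<open>x0\<close>;
  \<open>descent\<close> starts from \<open>xs\<close>, where the gradient term vanishes. This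
  settles large \<open>\<epsilon>\<close> without any iteration.\<close>

lemma expected_objective_start:
  "integrable (X 0) f \<and> (\<integral>x. f x \<partial>X 0) - f xs \<le> L / 2 * (enorm d (x0 - xs))\<^sup>2"
proof (rule expected_objective)
  have "f x0 - f xs \<le> L / 2 * (enorm d (x0 - xs))\<^sup>2"
    using descent[OF minimizer(1), of "x0 - xs"] gradient_at_minimizer[OF minimizer, of "x0 - xs"]
      x0 minimizer(1) by (simp add: enorm_sq)
  moreover have "mix 0 (x0, x0) = x0"
    by (simp add: mix_def)
  moreover have "(\<integral>\<^sup>+q. ennreal (f (mix 0 q) - f xs) \<partial>S 0) = ennreal (f (mix 0 (x0, x0)) - f xs)"
    unfolding acgd_state.simps
    by (rule nn_integral_return) (use x0 in \<open>auto simp: space_pair_measure\<close>)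
  ultimately show "(\<integral>\<^sup>+q. ennreal (f (mix 0 q) - f xs) \<partial>S 0) \<le> ennreal (L / 2 * (enorm d (x0 - xs))\<^sup>2)"
    by (simp add: ennreal_leI del: acgd_state.simps)
qed (use L_pos in simp)

text \<open>
  The potential controls \<open>f\<close> at \<open>y\<^sup>k\<close> only; passing to \<open>x\<^sup>k\<close> costs a multiple of the expected gain,
  which is small for some \<open>k\<close> in every dyadic block because the gains are summable.
\<close>

lemma expected_objective_rate:
  assumes N: "0 < N"
  obtains k where "k < 2 * N" "integrable (X k) f"
    "(\<integral>x. f x \<partial>X k) - f xs \<le> 5 * L * p\<^sup>2 * (enorm d (x0 - xs))\<^sup>2 / (real N)\<^sup>2"
proof -
  define r where "r = (enorm d (x0 - xs))\<^sup>2"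
  define D where "D k = (\<integral>\<^sup>+q. ennreal (gain k q) \<partial>S k)" for k
  have telescope: "(\<Sum>j<n. D j) + (\<integral>\<^sup>+q. ennreal (potential n q) \<partial>S n) \<le> ennreal (r / 2)" for n
    unfolding D_def r_def by (rule expected_potential_telescope)
  have "Min (D ` {N..<2 * N}) \<in> D ` {N..<2 * N}"
    using N by (intro Min_in) auto
  then obtain k where k: "k \<in> {N..<2 * N}" and D_k: "Min (D ` {N..<2 * N}) = D k"
    by blast
  have min: "D k \<le> D j" if "j \<in> {N..<2 * N}" for j
    unfolding D_k[symmetric] using that by (intro Min_le) auto
  have "of_nat (card {N..<2 * N}) * D k \<le> (\<Sum>j\<in>{N..<2 * N}. D j)"
    by (rule sum_bounded_below) (rule min)
  also have "\<dots> \<le> (\<Sum>j<2 * N. D j)"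
    by (intro sum_mono2) auto
  also have "\<dots> \<le> ennreal (r / 2)"
    by (rule order_trans[OF _ telescope[of "2 * N"]]) (rule add_increasing2, auto)
  finally have ND: "of_nat N * D k \<le> ennreal (r / 2)"
    by simp
  have "1 \<le> (of_nat N :: ennreal)"
    using N by (metis One_nat_def Suc_leI of_nat_1 of_nat_mono)
  then have "1 * D k \<le> of_nat N * D k"
    by (rule mult_right_mono) simp
  with ND have "D k < top"
    by (metis ennreal_less_top le_less_trans mult_1)
  then obtain \<delta> where \<delta>: "0 \<le> \<delta>" "D k = ennreal \<delta>"
    by (cases "D k") auto
  have "real N * \<delta> \<le> r / 2"
    using ND \<delta> by (simp add: r_def ennreal_of_nat_eq_real_of_nat flip: ennreal_mult)
  \<comment> \<open>From \<open>k \<le> 2 * N - 1\<close> and \<open>1 \<le> N\<close>.\<close>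
  moreover have "real k + 2 \<le> 3 * real N"
    using k N by auto
  then have "(real k + 2) * \<delta> \<le> 3 * real N * \<delta>"
    using \<delta>(1) by (rule mult_right_mono)
  moreover have "\<alpha> k * L * \<delta> \<le> (real k + 2) * \<delta> / 2"
  proof -
    have "\<alpha> k * L = (real k + 2) / 2 / p\<^sup>2"
      using L_pos by (simp add: \<alpha>_def)
    also have "\<dots> \<le> (real k + 2) / 2"
      using divide_left_mono[of 1 "p\<^sup>2" "(real k + 2) / 2"] p_ge_1 by simp
    finally show ?thesis
      using mult_right_mono[OF _ \<delta>(1)] by fastforce
  qed
  ultimately have cost: "\<alpha> k * L * \<delta> \<le> 3 / 4 * r"
    by simp
  define c where "c = (real k + 2)\<^sup>2 / (4 * L * p\<^sup>2)"
  have c: "0 < c"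
    using L_pos p_pos by (simp add: c_def)
  have "ennreal c * (\<integral>\<^sup>+q. ennreal (f (mix k q) - f xs) \<partial>S k)
      = (\<integral>\<^sup>+q. ennreal c * ennreal (f (mix k q) - f xs) \<partial>S k)"
    by (intro nn_integral_cmult[symmetric]) (simp add: measurable_cong_sets[OF sets_S refl])
  also have "\<dots> \<le> (\<integral>\<^sup>+q. ennreal (potential k q) + ennreal (\<alpha> k * L) * ennreal (gain k q) \<partial>S k)"
  proof (rule nn_integral_mono)
    fix q assume "q \<in> space (S k)"
    then have q: "q \<in> Rd d \<times> Rd d"
      by (simp add: space_S)
    have "0 \<le> \<alpha> k * L"
      using \<alpha>_pos[of k] L_pos by simp
    moreover have "f xs \<le> f (mix k q)"
      using q by (intro minimizer(2)) simp
    ultimately show "ennreal c * ennreal (f (mix k q) - f xs)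
        \<le> ennreal (potential k q) + ennreal (\<alpha> k * L) * ennreal (gain k q)"
      using objective_at_mix[OF q, of k] c potential_nonneg[OF q] gain_nonneg
      by (simp add: c_def ennreal_leI flip: ennreal_mult ennreal_plus)
  qed
  also have "\<dots> = (\<integral>\<^sup>+q. ennreal (potential k q) \<partial>S k) + ennreal (\<alpha> k * L) * D k"
    unfolding D_def
    by (subst nn_integral_add) (simp_all add: nn_integral_cmult measurable_cong_sets[OF sets_S refl])
  \<comment> \<open>The total \<open>5 / 4 * r\<close>, divided by \<open>c\<close>, produces the
    constant 5 of the rate.\<close>
  also have "\<dots> \<le> ennreal (r / 2) + ennreal (3 / 4 * r)"
  proof (rule add_mono)
    show "(\<integral>\<^sup>+q. ennreal (potential k q) \<partial>S k) \<le> ennreal (r / 2)"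
      by (rule order_trans[OF _ telescope[of k]]) (rule add_increasing, auto)
    show "ennreal (\<alpha> k * L) * D k \<le> ennreal (3 / 4 * r)"
      using cost \<delta> \<alpha>_pos[of k] L_pos by (simp add: ennreal_leI flip: ennreal_mult)
  qed
  also have "\<dots> = ennreal (5 / 4 * r)"
    by (simp add: r_def flip: ennreal_plus)
  finally have cI: "ennreal c * (\<integral>\<^sup>+q. ennreal (f (mix k q) - f xs) \<partial>S k) \<le> ennreal (5 / 4 * r)" .
  have "(\<integral>\<^sup>+q. ennreal (f (mix k q) - f xs) \<partial>S k)
      = ennreal (1 / c) * (ennreal c * (\<integral>\<^sup>+q. ennreal (f (mix k q) - f xs) \<partial>S k))"
    using c by (simp flip: ennreal_mult mult.assoc)
  also have "\<dots> \<le> ennreal (1 / c) * ennreal (5 / 4 * r)"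
    using cI by (rule mult_left_mono) simp
  also have "\<dots> = ennreal (5 / 4 * r / c)"
    using c by (simp add: r_def flip: ennreal_mult)
  also have "\<dots> \<le> ennreal (5 * L * p\<^sup>2 * r / (real N)\<^sup>2)"
  proof (rule ennreal_leI)
    have "(real N)\<^sup>2 \<le> (real k + 2)\<^sup>2"
      using k by (intro power_mono) auto
    then have "5 * L * p\<^sup>2 * r / (real k + 2)\<^sup>2 \<le> 5 * L * p\<^sup>2 * r / (real N)\<^sup>2"
      using L_pos N by (intro divide_left_mono) (auto simp: r_def)
    then show "5 / 4 * r / c \<le> 5 * L * p\<^sup>2 * r / (real N)\<^sup>2"
      by (simp add: c_def mult_ac)
  qed
  finally have "integrable (X k) f \<and> (\<integral>x. f x \<partial>X k) - f xs \<le> 5 * L * p\<^sup>2 * r / (real N)\<^sup>2"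
    using L_pos by (intro expected_objective) (simp_all add: r_def)
  with k that show ?thesis
    by (auto simp: r_def)
qed

section \<open>Number of iterations for accuracy \<open>\<epsilon>\<close>\<close>

text \<open>The allowed number of iterations may be below 1, so the start is tested first. If it
  fails, the real-valued count \<open>s\<close> is at least 1 and rounding costs only a constant
  factor.\<close>

lemma iteration_complexity:
  assumes \<epsilon>: "0 < \<epsilon>"
  shows "\<exists>k. real k \<le> (8 * enorm d (x0 - xs) + 1) * (1 + \<omega>) * sqrt (L / \<epsilon>) \<and>
    integrable (X k) f \<and> (\<integral>x. f x \<partial>X k) - f xs \<le> \<epsilon>"
proof (cases "L / 2 * (enorm d (x0 - xs))\<^sup>2 \<le> \<epsilon>")
  case True
  have "real 0 \<le> (8 * enorm d (x0 - xs) + 1) * (1 + \<omega>) * sqrt (L / \<epsilon>)"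
    using L_pos \<epsilon> omega_nonneg by simp
  then show ?thesis
    using expected_objective_start True by (meson order_trans)
next
  case False
  define R where "R = enorm d (x0 - xs)"
  define s where "s = R * p * sqrt (L / \<epsilon>)"
  have large: "2 * \<epsilon> < L * R\<^sup>2"
    using False by (simp add: R_def)
  have R: "0 \<le> R"
    by (simp add: R_def)
  have s2: "s\<^sup>2 = R\<^sup>2 * p\<^sup>2 * (L / \<epsilon>)"
    using L_pos \<epsilon> by (simp add: s_def power_mult_distrib)
  have "1 \<le> L * R\<^sup>2 / \<epsilon>"
    using large \<epsilon> by (simp add: field_simps)
  moreover have "1 \<le> p\<^sup>2"
    using p_ge_1 by simp
  ultimately have "1 * 1 \<le> (L * R\<^sup>2 / \<epsilon>) * p\<^sup>2"
    by (intro mult_mono) auto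
  then have "1 \<le> s\<^sup>2"
    by (simp add: s2 mult_ac)
  moreover have "0 \<le> s"
    using R p_pos L_pos \<epsilon> by (simp add: s_def)
  ultimately have s: "1 \<le> s"
    by (metis one_power2 power2_le_imp_le)
  \<comment> \<open>The factor 3 suffices because \<open>5 \<le> 3\<^sup>2\<close>; with
    \<open>1 \<le> s\<close> it gives \<open>2 * N \<le> 6 * s + 2 \<le> 8 * s\<close>.\<close>
  define N where "N = nat \<lceil>3 * s\<rceil>"
  have N: "3 * s \<le> real N" "real N \<le> 3 * s + 1"
    using s unfolding N_def by linarith+
  then have "0 < N"
    using s by (cases N) auto
  then obtain k where k: "k < 2 * N" "integrable (X k) f"
    "(\<integral>x. f x \<partial>X k) - f xs \<le> 5 * L * p\<^sup>2 * R\<^sup>2 / (real N)\<^sup>2"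
    unfolding R_def by (rule expected_objective_rate)
  have "5 * L * p\<^sup>2 * R\<^sup>2 = 5 * s\<^sup>2 * \<epsilon>"
    using \<epsilon> by (simp add: s2)
  also have "\<dots> \<le> (3 * s)\<^sup>2 * \<epsilon>"
    using \<epsilon> by (simp add: power2_eq_square)
  also have "\<dots> \<le> (real N)\<^sup>2 * \<epsilon>"
    using N(1) s \<epsilon> by (intro mult_right_mono power_mono) auto
  finally have "5 * L * p\<^sup>2 * R\<^sup>2 / (real N)\<^sup>2 \<le> \<epsilon>"
    using \<open>0 < N\<close> by (simp add: divide_le_eq mult.commute)
  moreover have "real k \<le> (8 * R + 1) * (1 + \<omega>) * sqrt (L / \<epsilon>)"
  proof -
    have "real k \<le> 2 * real N"
      using k(1) by linarith
    also have "\<dots> \<le> 8 * s"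
      using N(2) s by linarith
    also have "\<dots> \<le> (8 * R + 1) * (1 + \<omega>) * sqrt (L / \<epsilon>)"
      using p_pos L_pos \<epsilon> by (simp add: s_def p_def[symmetric] algebra_simps)
    finally show ?thesis .
  qed
  ultimately show ?thesis
    using k unfolding R_def by (meson order_trans)
qed

end

text \<open>Fixing \<open>R\<close> before the constant and all other data after it expresses
  dependence on the initial distance alone. Integrability is asserted because the integral would
  otherwise default to 0.\<close>

theorem theorem2:
  fixes R :: real
  shows "\<exists>c>0. \<forall>(d::nat) (f :: rvec \<Rightarrow> real) (G :: rvec \<Rightarrow> rvec) (L::real) (\<omega>::real)
      (C :: rvec \<Rightarrow> rvec measure) (x0 :: rvec) (xstar :: rvec) (p::real).
    convex_on (Rd d) f \<longrightarrow>
    (\<forall>x\<in>Rd d. has_gradient d f x (G x)) \<longrightarrow>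
    L > 0 \<longrightarrow>
    (\<forall>x\<in>Rd d. \<forall>y\<in>Rd d. enorm d (G x - G y) \<le> L * enorm d (x - y)) \<longrightarrow>
    xstar \<in> Rd d \<longrightarrow> (\<forall>x\<in>Rd d. f xstar \<le> f x) \<longrightarrow>
    \<omega> \<ge> 0 \<longrightarrow> compression_operator d \<omega> C \<longrightarrow>
    x0 \<in> Rd d \<longrightarrow> enorm d (x0 - xstar) = R \<longrightarrow>
    p = 1 + \<omega> \<longrightarrow>
    (\<forall>\<epsilon>>0. \<exists>k::nat. real k \<le> c * (1 + \<omega>) * sqrt (L / \<epsilon>) \<and>
      (let X = acgd_iterate d C G (\<lambda>k. 1 / L) (\<lambda>k. real k / (real k + 2)) (\<lambda>k. 0)
                 (\<lambda>k. 2 * p / (real k + 2)) p x0 k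
       in integrable X f \<and> (\<integral>x. f x \<partial>X) - f xstar \<le> \<epsilon>))"
proof (cases "0 \<le> R")
  case True
  show ?thesis
  \<comment> \<open>The summand 1 keeps the constant positive when \<open>R = 0\<close>.\<close>
  proof (intro exI[of _ "8 * R + 1"] conjI allI impI)
    fix d f G L \<omega> C x0 xs and p \<epsilon> :: real
    assume asm: "convex_on (Rd d) f" "\<forall>x\<in>Rd d. has_gradient d f x (G x)" "0 < L"
      "\<forall>x\<in>Rd d. \<forall>y\<in>Rd d. enorm d (G x - G y) \<le> L * enorm d (x - y)"
      "xs \<in> Rd d" "\<forall>x\<in>Rd d. f xs \<le> f x" "0 \<le> \<omega>" "compression_operator d \<omega> C"
      "x0 \<in> Rd d" "enorm d (x0 - xs) = R" "p = 1 + \<omega>" "0 < \<epsilon>"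
    then interpret acgd_run d f G L \<omega> C x0 xs p
      by unfold_locales auto
    show "\<exists>k::nat. real k \<le> (8 * R + 1) * (1 + \<omega>) * sqrt (L / \<epsilon>) \<and>
      (let X = acgd_iterate d C G (\<lambda>k. 1 / L) (\<lambda>k. real k / (real k + 2)) (\<lambda>k. 0)
                 (\<lambda>k. 2 * p / (real k + 2)) p x0 k
       in integrable X f \<and> (\<integral>x. f x \<partial>X) - f xs \<le> \<epsilon>)"
      using iteration_complexity[OF \<open>0 < \<epsilon>\<close>] by (simp add: Let_def \<open>enorm d (x0 - xs) = R\<close>)
  qed (use True in simp)
next
  case False
  \<comment> \<open>No distance equals a negative \<open>R\<close>, so any positive constant
    works.\<close>
  then have "enorm d v \<noteq> R" for d v
    using enorm_nonneg[of d v] by auto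
  then show ?thesis
    by (intro exI[of _ 1]) auto
qed

end
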